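(* Let $A\in\mathbb{Z}^{r\times c}$ and $M\in\mathbb{Z}_+$. Suppose $\sum_{i=0}^k h_i\,\mathbf{x}^i=\mathbf{0}$ is a primitive relation on elements $\mathbf{x}^0,\dots,\mathbf{x}^k\in\mathcal{G}(A^{(M)})$ with positive integer coefficients $h_i$, satisfying: (a) $\mathbf{x}^0$ has the form $(\mathbf{x}^0)^\top=(\mathbf{x}_1,\ldots,\mathbf{x}_{g-1},\mathbf{0},\ldots,\mathbf{0},\mathbf{x}_g)^\top$ (i.e. its bricks $1,\dots,g-1$ are $\mathbf{x}_1,\dots,\mathbf{x}_{g-1}$, its bricks $g,\dots,M-1$ are zero and its $M$-th brick is $\mathbf{x}_g$), where $g:=\mathrm{type}(\mathbf{x}^0)>2$ and $\sum_{i=1}^g 1\cdot\mathbf{x}_i=\mathbf{0}$ is a primitive relation on the vectors $\mathbf{x}_1,\dots,\mathbf{x}_g\in\mathbb{Z}^c$; (b) for some $l\in\mathbb{Z}_+$ with $l\le k$, the last ($M$-th) brick of each of $\mathbf{x}^1,\ldots,\mathbf{x}^l$ equals $-\mathbf{x}_g$; (c) $h_0+s=h_1+\cdots+h_l$ for some $s\in\mathbb{Z}$ with $\gcd(g-1,s)=1$. Then there is a primitive relation $\sum_{i=0}^{k+g-1}\bar h_i\,\mathbf{y}^i=\mathbf{0}$ on $k+g$ elements $\mathbf{y}^0,\dots,\mathbf{y}^{k+g-1}\in\mathcal{G}(A^{(M+1)})$ such that \[\sum_{i=0}^{k+g-1}\bar h_i=\begin{cases}(g-1)\sum_{i=0}^k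 h_i+(2g-3)s & \text{if } s\ge 0,\\ (g-1)\sum_{i=0}^k h_i-s & \text{if } s<0,\end{cases}\] and this quantity is a lower bound on the Graver complexity $g(A^{(M+1)})$.
   Context: For $A\in\mathbb{Z}^{r\times c}$ and $M\ge1$, the $M$-fold matrix $A^{(M)}\in\mathbb{Z}^{(c+Mr)\times(Mc)}$ is the block matrix whose first block row is $(I_c\ I_c\ \cdots\ I_c)$ ($M$ copies of the $c\times c$ identity) and below which is the block-diagonal matrix $\mathrm{diag}(A,\dots,A)$ ($M$ copies). Vectors $\mathbf{x}\in\mathbb{Z}^{Mc}$ are written as $M\times c$ tables $\mathbf{x}=(\mathbf{x}_1,\dots,\mathbf{x}_M)^\top$ with bricks $\mathbf{x}_j\in\mathbb{Z}^c$; $\mathbf{x}\in\ker A^{(M)}$ iff every brick lies in $\ker A$ and the bricks sum to $\mathbf{0}$. The type of $\mathbf{x}$ is the number of nonzero bricks. For an integer matrix $C\in\mathbb{Z}^{d\times n}$, its Graver basis $\mathcal{G}(C)$ is the set of $\sqsubseteq$-minimal elements of $(\ker C\cap\mathbb{Z}^n)\setminus\{\mathbf{0}\}$, where $\mathbf{u}\sqsubseteq\mathbf{v}$ means $u_jv_j\ge0$ and $|u_j|\le|v_j|$ for all $j$. The Graver complexity $g(C)$ of $C\in\mathbb{Z}^{d\times n}$ is the maximum, over all $N$, of the types of elements of the Graver basis of the $N$-fold matrix of $C$ (first block row $N$ copies of $I_n$, then $\mathrm{diag}(C,\dots,C)$), bricks now being in $\mathbb{Z}^n$; equivalently $g(C)=\max\{\|\mathbf{h}\|_1:\mathbf{h}\in\mathcal{G}(\mathcal{G}(C))\}$,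 where $\mathcal{G}(C)$ is viewed as the matrix whose columns are the Graver basis elements. A linear relation $\sum_{i=1}^k h_i\mathbf{x}^i=\mathbf{0}$ on integer vectors is primitive if the $h_i$ are relatively prime nonzero integers and no $k-1$ of the vectors $\mathbf{x}^1,\dots,\mathbf{x}^k$ satisfy any nontrivial linear relation. $\mathbb{Z}_+$ denotes the nonnegative integers. *)

theory Defs
  imports
    "HOL-Library.Extended_Nat"
    "Jordan_Normal_Form.Matrix_Kernel"
begin

definition nfold_mat :: "nat \<Rightarrow> int mat \<Rightarrow> int mat" where
  "nfold_mat M A =
     mat (dim_col A) (M * dim_col A) (\<lambda>(i, j). if j mod dim_col A = i then 1 else 0)
     @\<^sub>r diag_block_mat (replicate M A)"

text \<open>Bricks are numbered from \<open>0\<close>: a vector of dimension \<open>M * c\<close> has the bricks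
  \<open>brick c x 0, \<dots>, brick c x (M - 1)\<close>.\<close>

definition brick :: "nat \<Rightarrow> int vec \<Rightarrow> nat \<Rightarrow> int vec" where
  "brick c x j = vec c (\<lambda>i. x $ (j * c + i))"

definition brick_type :: "nat \<Rightarrow> nat \<Rightarrow> int vec \<Rightarrow> nat" where
  "brick_type c M x = card {j. j < M \<and> brick c x j \<noteq> 0\<^sub>v c}"

definition conformal_le :: "int vec \<Rightarrow> int vec \<Rightarrow> bool" (infix \<open>\<sqsubseteq>\<^sub>c\<close> 50) where
  "u \<sqsubseteq>\<^sub>c v \<longleftrightarrow> dim_vec u = dim_vec v \<and>
     (\<forall>j < dim_vec v. u $ j * v $ j \<ge> 0 \<and> \<bar>u $ j\<bar> \<le> \<bar>v $ j\<bar>)"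

definition graver_basis :: "int mat \<Rightarrow> int vec set" where
  "graver_basis C =
     {v \<in> mat_kernel C - {0\<^sub>v (dim_col C)}.
        \<forall>u \<in> mat_kernel C - {0\<^sub>v (dim_col C)}. u \<sqsubseteq>\<^sub>c v \<longrightarrow> u = v}"

definition graver_types :: "int mat \<Rightarrow> nat set" where
  "graver_types C =
     {brick_type (dim_col C) N x | N x. N \<ge> 1 \<and> x \<in> graver_basis (nfold_mat N C)}"

text \<open>The maximum of the types. It is taken as a supremum in \<^typ>\<open>enat\<close>, so that the definition
  does not depend on the finiteness of \<^term>\<open>graver_types C\<close>; if that set is empty, the value
  is \<open>0\<close>.\<close>

definition graver_complexity :: "int mat \<Rightarrow> enat" where
  "graver_complexity C = (SUP t \<in> graver_types C. enat t)"

lemma graver_complexity_eq_Max: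
  assumes "finite (graver_types C)" and "graver_types C \<noteq> {}"
  shows "graver_complexity C = enat (Max (graver_types C))"
  unfolding graver_complexity_def
proof (rule antisym)
  show "(SUP t \<in> graver_types C. enat t) \<le> enat (Max (graver_types C))"
    using assms by (intro SUP_least) simp
  show "enat (Max (graver_types C)) \<le> (SUP t \<in> graver_types C. enat t)"
    using assms by (intro SUP_upper Max_in)
qed

definition linear_relation :: "nat \<Rightarrow> 'i set \<Rightarrow> ('i \<Rightarrow> int) \<Rightarrow> ('i \<Rightarrow> int vec) \<Rightarrow> bool" where
  "linear_relation n I h x \<longleftrightarrow> finsum_vec TYPE(int) n (\<lambda>i. h i \<cdot>\<^sub>v x i) I = 0\<^sub>v n"

text \<open>The coefficients are relatively prime as a whole, not pairwise. Relations are between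
  indexed families, so repeated vectors count separately.\<close>

definition primitive_relation :: "nat \<Rightarrow> 'i set \<Rightarrow> ('i \<Rightarrow> int) \<Rightarrow> ('i \<Rightarrow> int vec) \<Rightarrow> bool" where
  "primitive_relation n I h x \<longleftrightarrow>
     finite I \<and> (\<forall>i \<in> I. x i \<in> carrier_vec n) \<and>
     linear_relation n I h x \<and>
     (\<forall>i \<in> I. h i \<noteq> 0) \<and> Gcd (h ` I) = 1 \<and>
     (\<forall>j \<in> I. \<forall>a. linear_relation n (I - {j}) a x \<longrightarrow> (\<forall>i \<in> I - {j}. a i = 0))"

end

theory Submission
  imports Defs
begin

text \<open>In \<open>x\<^sup>0, \<dots>, x\<^sup>l\<close> move the \<open>M\<close>-th brick to the new position \<open>M + 1\<close>, and pad
  \<open>x\<^sup>l\<^sup>+\<^sup>1, \<dots>, x\<^sup>k\<close> by a zero brick. For \<open>m < g\<close> let \<open>z\<^sub>m\<close> be \<open>x\<^sup>0\<close> with its \<open>m\<close>-th brick moved to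
  position \<open>M + 1\<close>. All of these are Graver basis elements. In a relation between them, brick
  \<open>M + 1\<close> is a relation between the \<open>x\<^sub>i\<close>, so primitivity in (a) forces the coefficients of all
  \<open>z\<^sub>m\<close> to equal one number \<open>\<tau>\<close>, where \<open>\<tau>\<close> is the coefficient of \<open>x\<^sup>0\<close> minus those of
  \<open>x\<^sup>1, \<dots>, x\<^sup>l\<close>. What remains is a relation between the \<open>x\<^sup>i\<close> in which the coefficient of \<open>x\<^sup>0\<close> is
  increased by \<open>(g - 2) \<tau>\<close>, hence a multiple \<open>t h\<close> of the given one, and \<open>(g - 1) \<tau> = - t s\<close>.
  Since \<open>gcd (g - 1) s = 1\<close>, the primitive solution is \<open>t = g - 1\<close>, \<open>\<tau> = - s\<close>; replacing \<open>z\<^sub>m\<close> by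
  \<open>- z\<^sub>m\<close> if \<open>s > 0\<close> makes all coefficients positive. A positive primitive relation bounds the
  Graver complexity from below by the sum of its coefficients.\<close>

section \<open>Linear and primitive relations\<close>

text \<open>Division with remainder by \<open>c\<close> turns an entry index into a brick number and
  a position in that brick; this lets vectors be treated brick by brick.\<close>

lemma all_less_mult_iff:
  fixes M c :: nat
  shows "(\<forall>p < M * c. P p) \<longleftrightarrow> (\<forall>j < M. \<forall>i < c. P (j * c + i))"
proof safe
  fix j i assume "\<forall>p < M * c. P p" "j < M" "i < c"
  moreover have "j * c + i < M * c"
  proof -
    have "j * c + i < Suc j * c" using \<open>i < c\<close> by simp
    also have "\<dots> \<le> M * c" using \<open>j < M\<close> by (intro mult_right_mono) auto
    finally show ?thesis .
  qed
  ultimately show "P (j * c + i)" by blast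
next
  fix p assume H: "\<forall>j < M. \<forall>i < c. P (j * c + i)" and p: "p < M * c"
  then have "p div c < M" "p mod c < c"
    by (simp_all add: less_mult_imp_div_less, metis mod_less_divisor mult_0_right neq0_conv not_less0)
  then show "P p" using H by (metis div_mult_mod_eq)
qed

lemma brick_index_less:
  assumes "j < (M :: nat)" "i < c"
  shows "j * c + i < M * c"
  using all_less_mult_iff[of M c "\<lambda>p. p < M * c"] assms by blast

lemma linear_relation_iff:
  assumes "finite I" "x \<in> I \<rightarrow> carrier_vec n"
  shows "linear_relation n I a x \<longleftrightarrow> (\<forall>p < n. (\<Sum>i\<in>I. a i * x i $ p) = 0)"
proof -
  have cl: "(\<lambda>i. a i \<cdot>\<^sub>v x i) \<in> I \<rightarrow> carrier_vec n"
    using assms by auto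
  have d: "dim_vec (finsum_vec TYPE(int) n (\<lambda>i. a i \<cdot>\<^sub>v x i) I) = n"
    using finsum_vec_closed[OF cl] by auto
  have e: "finsum_vec TYPE(int) n (\<lambda>i. a i \<cdot>\<^sub>v x i) I $ p = (\<Sum>i\<in>I. a i * x i $ p)" if "p < n" for p
  proof -
    have "finsum_vec TYPE(int) n (\<lambda>i. a i \<cdot>\<^sub>v x i) I $ p = (\<Sum>i\<in>I. (a i \<cdot>\<^sub>v x i) $ p)"
      by (rule index_finsum_vec[OF assms(1) that cl])
    also have "\<dots> = (\<Sum>i\<in>I. a i * x i $ p)"
    proof (rule sum.cong[OF refl])
      fix i assume "i \<in> I"
      then have "dim_vec (x i) = n" using assms(2) by (metis carrier_vecD funcset_mem)
      then show "(a i \<cdot>\<^sub>v x i) $ p = a i * x i $ p" using that by simp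
    qed
    finally show ?thesis .
  qed
  show ?thesis
    unfolding linear_relation_def vec_eq_iff using d e by auto
qed

lemma linear_relation_bricks_iff:
  assumes "finite I" "x \<in> I \<rightarrow> carrier_vec (M * c)"
  shows "linear_relation (M * c) I a x \<longleftrightarrow>
    (\<forall>j < M. \<forall>p < c. (\<Sum>i\<in>I. a i * brick c (x i) j $ p) = 0)"
  unfolding linear_relation_iff[OF assms] all_less_mult_iff by (simp add: brick_def)

text \<open>Lets the independence clause of primitivity be used with a fixed index set.\<close>

lemma linear_relation_Diff_iff:
  assumes "finite I" "x \<in> I \<rightarrow> carrier_vec n" "j \<in> I"
  shows "linear_relation n (I - {j}) a x \<longleftrightarrow> linear_relation n I (a(j := 0)) x"
proof -
  have "(\<Sum>i\<in>I. (a(j := 0)) i * x i $ p) = (\<Sum>i\<in>I - {j}. a i * x i $ p)" for p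
    by (subst sum.remove[OF assms(1,3)]) (auto intro!: sum.cong)
  moreover have "finite (I - {j})" "x \<in> I - {j} \<rightarrow> carrier_vec n"
    using assms by auto
  ultimately show ?thesis
    using assms by (simp only: linear_relation_iff)
qed

text \<open>Independence makes \<open>a\<close> a rational multiple of \<open>h\<close>, and
  coprimality of the \<open>h i\<close> makes the factor an integer.\<close>

lemma primitive_relation_multiple:
  assumes P: "primitive_relation n I h x" and L: "linear_relation n I a x"
  obtains t where "\<And>i. i \<in> I \<Longrightarrow> a i = t * h i"
proof (cases "I = {}")
  case True
  then show ?thesis using that by auto
next
  case False
  then obtain j where j: "j \<in> I" by blast
  have fin: "finite I" and x: "x \<in> I \<rightarrow> carrier_vec n"
    and h: "linear_relation n I h x" "h j \<noteq> 0" "Gcd (h ` I) = 1"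
    and ind: "\<And>a i. linear_relation n (I - {j}) a x \<Longrightarrow> i \<in> I - {j} \<Longrightarrow> a i = 0"
    using P j unfolding primitive_relation_def by (blast intro: funcsetI)+
  \<comment> \<open>The coefficient of \<open>x j\<close> cancels, so this is a relation among the
    other vectors.\<close>
  let ?d = "\<lambda>i. h j * a i - a j * h i"
  have "linear_relation n I ?d x"
    using L h(1) by (auto simp: linear_relation_iff[OF fin x] left_diff_distrib
        sum_subtractf mult.assoc simp flip: sum_distrib_left)
  moreover have "?d(j := 0) = ?d" by auto
  ultimately have "linear_relation n (I - {j}) ?d x"
    using linear_relation_Diff_iff[OF fin x j] by metis
  then have d: "h j * a i = a j * h i" if "i \<in> I" for i
    using ind[of ?d i] that by (cases "i = j") auto
  \<comment> \<open>By coprimality of the \<open>h i\<close>, the gcd of the products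
    \<open>a j * h i\<close> is \<open>a j\<close> up to sign.\<close>
  have "h j dvd Gcd ((*) (a j) ` h ` I)"
    by (rule Gcd_greatest) (auto simp flip: d)
  then have "h j dvd a j"
    by (simp add: Gcd_mult h(3))
  then obtain t where "a j = h j * t" ..
  then have "a i = t * h i" if "i \<in> I" for i
    using d[OF that] h(2) by (metis mult.assoc mult.commute mult_cancel_left)
  then show ?thesis using that by blast
qed

lemma primitive_relationI:
  assumes fin: "finite I" and x: "x \<in> I \<rightarrow> carrier_vec n"
    and "linear_relation n I h x" "\<And>i. i \<in> I \<Longrightarrow> h i \<noteq> 0" "Gcd (h ` I) = 1"
    and ind: "\<And>a i j. linear_relation n I a x \<Longrightarrow> j \<in> I \<Longrightarrow> a j = 0 \<Longrightarrow> i \<in> I \<Longrightarrow> a i = 0"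
  shows "primitive_relation n I h x"
proof -
  have "a i = 0" if "j \<in> I" "linear_relation n (I - {j}) a x" "i \<in> I - {j}" for a i j
  proof -
    have "linear_relation n I (a(j := 0)) x"
      using that linear_relation_Diff_iff[OF fin x that(1)] by blast
    then have "(a(j := 0)) i = 0"
      by (rule ind[OF _ that(1)]) (use that in auto)
    then show ?thesis using that by auto
  qed
  then show ?thesis
    using assms unfolding primitive_relation_def by (blast dest: funcset_mem)
qed

section \<open>Bricks and the kernel of an N-fold matrix\<close>

lemma brick_carrier [simp]: "brick c v j \<in> carrier_vec c" and dim_brick [simp]: "dim_vec (brick c v j) = c"
  and index_brick [simp]: "i < c \<Longrightarrow> brick c v j $ i = v $ (j * c + i)"
  by (auto simp: brick_def)

lemma brick_zero: "j < M \<Longrightarrow> brick c (0\<^sub>v (M * c)) j = 0\<^sub>v c"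
  by (auto simp: brick_index_less)

lemma eq_bricksI:
  assumes "u \<in> carrier_vec (M * c)" "v \<in> carrier_vec (M * c)"
    "\<And>j. j < M \<Longrightarrow> brick c u j = brick c v j"
  shows "u = v"
proof -
  have "\<forall>p < M * c. u $ p = v $ p"
    unfolding all_less_mult_iff using assms(3) by (metis index_brick)
  then show ?thesis using assms by auto
qed

lemma conformal_le_bricks_iff:
  assumes "u \<in> carrier_vec (M * c)" "v \<in> carrier_vec (M * c)"
  shows "u \<sqsubseteq>\<^sub>c v \<longleftrightarrow> (\<forall>j < M. brick c u j \<sqsubseteq>\<^sub>c brick c v j)"
proof -
  have "dim_vec u = M * c" "dim_vec v = M * c" using assms by auto
  then show ?thesis
    unfolding conformal_le_def by (simp add: all_less_mult_iff)
qed

lemma diag_block_mat_replicate_carrier: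
  "A \<in> carrier_mat r c \<Longrightarrow> diag_block_mat (replicate M A) \<in> carrier_mat (M * r) (M * c)"
  by (intro carrier_matI) (auto simp: dim_diag_block_mat sum_list_replicate)

text \<open>Induction on \<open>M\<close>: splitting off the first brick exhibits the matrix as a
  two by two block matrix with zero off-diagonal blocks.\<close>

lemma diag_block_mat_replicate_mult_eq_0_iff:
  assumes A: "A \<in> carrier_mat r c" and "v \<in> carrier_vec (M * c)"
  shows "diag_block_mat (replicate M A) *\<^sub>v v = 0\<^sub>v (M * r) \<longleftrightarrow>
    (\<forall>j < M. A *\<^sub>v brick c v j = 0\<^sub>v r)"
  using assms(2)
proof (induction M arbitrary: v)
  case 0
  then show ?case by (auto intro!: eq_vecI)
next
  case (Suc M)
  define w where "w = vec_last v (M * c)"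
  have v: "v \<in> carrier_vec (c + M * c)" using Suc.prems by simp
  have w: "w \<in> carrier_vec (M * c)" by (simp add: w_def)
  have first: "vec_first v c = brick c v 0"
    by (auto simp: vec_first_def brick_def)
  have bw: "brick c w j = brick c v (Suc j)" if "j < M" for j
    using v brick_index_less[OF that] by (auto simp: w_def vec_last_def add.assoc)
  have split: "v = brick c v 0 @\<^sub>v w"
    using v first w_def by (metis vec_first_last_append)
  let ?D = "diag_block_mat (replicate M A)"
  have D: "?D \<in> carrier_mat (M * r) (M * c)"
    by (rule diag_block_mat_replicate_carrier[OF A])
  have blk: "diag_block_mat (replicate (Suc M) A) = four_block_mat A (0\<^sub>m r (M * c)) (0\<^sub>m (M * r) c) ?D"
    using A D by (simp add: Let_def)
  have "diag_block_mat (replicate (Suc M) A) *\<^sub>v v = A *\<^sub>v brick c v 0 @\<^sub>v ?D *\<^sub>v w"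
    unfolding blk by (subst split, subst four_block_mat_mult_vec[OF A _ _ D brick_carrier w])
      (use A D w in auto)
  moreover have "(0\<^sub>v (Suc M * r) :: int vec) = 0\<^sub>v r @\<^sub>v 0\<^sub>v (M * r)"
    by (auto intro!: eq_vecI)
  moreover have "A *\<^sub>v brick c v 0 @\<^sub>v ?D *\<^sub>v w = 0\<^sub>v r @\<^sub>v 0\<^sub>v (M * r) \<longleftrightarrow>
      A *\<^sub>v brick c v 0 = 0\<^sub>v r \<and> ?D *\<^sub>v w = 0\<^sub>v (M * r)"
    by (rule append_vec_eq[of _ r]) (use A in auto)
  ultimately have "diag_block_mat (replicate (Suc M) A) *\<^sub>v v = 0\<^sub>v (Suc M * r) \<longleftrightarrow>
      A *\<^sub>v brick c v 0 = 0\<^sub>v r \<and> ?D *\<^sub>v w = 0\<^sub>v (M * r)"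
    by (simp only:)
  also have "\<dots> \<longleftrightarrow> A *\<^sub>v brick c v 0 = 0\<^sub>v r \<and> (\<forall>j < M. A *\<^sub>v brick c v (Suc j) = 0\<^sub>v r)"
    using Suc.IH[OF w] bw by simp
  also have "\<dots> \<longleftrightarrow> (\<forall>j < Suc M. A *\<^sub>v brick c v j = 0\<^sub>v r)"
    by (simp add: All_less_Suc2)
  finally show ?case .
qed

lemma nfold_mat_carrier: "A \<in> carrier_mat r c \<Longrightarrow> nfold_mat M A \<in> carrier_mat (c + M * r) (M * c)"
  unfolding nfold_mat_def by (intro carrier_append_rows diag_block_mat_replicate_carrier) auto

text \<open>The identity blocks yield the condition on the sum of the bricks, the diagonal blocks
  the kernel condition on each brick.\<close>

lemma mat_kernel_nfold_iff:
  assumes A: "A \<in> carrier_mat r c"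
  shows "v \<in> mat_kernel (nfold_mat M A) \<longleftrightarrow> v \<in> carrier_vec (M * c) \<and>
    (\<forall>j < M. brick c v j \<in> mat_kernel A) \<and> (\<forall>i < c. (\<Sum>j<M. brick c v j $ i) = 0)"
proof (cases "v \<in> carrier_vec (M * c)")
  case v: True
  define E where "E = mat c (M * c) (\<lambda>(i, j). if j mod c = i then 1 else 0 :: int)"
  have E: "E \<in> carrier_mat c (M * c)" by (simp add: E_def)
  have Ev: "(E *\<^sub>v v) $ i = (\<Sum>j<M. brick c v j $ i)" if i: "i < c" for i
  proof -
    have "(E *\<^sub>v v) $ i = (\<Sum>p<M * c. (if p mod c = i then 1 else 0) * v $ p)"
      using v i by (auto simp: E_def scalar_prod_def atLeast0LessThan intro!: sum.cong)
    also have "\<dots> = (\<Sum>j<M. \<Sum>p = j * c..<j * c + c. (if p mod c = i then 1 else 0) * v $ p)"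
      by (rule sum.nat_group[symmetric])
    also have "\<dots> = (\<Sum>j<M. v $ (j * c + i))"
    proof (rule sum.cong[OF refl])
      fix j
      have "(\<Sum>p = j * c..<j * c + c. (if p mod c = i then 1 else 0) * v $ p) =
          (\<Sum>q<c. (if q = i then 1 else 0) * v $ (j * c + q))"
        by (simp add: sum.atLeastLessThan_shift_0[of _ "j * c"] atLeast0LessThan cong: if_cong)
      then show "(\<Sum>p = j * c..<j * c + c. (if p mod c = i then 1 else 0) * v $ p) = v $ (j * c + i)"
        using i by (simp add: if_distrib[of "\<lambda>z. z * _"] cong: if_cong)
    qed
    finally show ?thesis using i by simp
  qed
  let ?D = "diag_block_mat (replicate M A)"
  have D: "?D \<in> carrier_mat (M * r) (M * c)" by (rule diag_block_mat_replicate_carrier[OF A])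
  have "nfold_mat M A *\<^sub>v v = (E *\<^sub>v v) @\<^sub>v (?D *\<^sub>v v)"
    unfolding nfold_mat_def using mat_mult_append[OF E D v] A by (simp add: E_def)
  moreover have "(0\<^sub>v (c + M * r) :: int vec) = 0\<^sub>v c @\<^sub>v 0\<^sub>v (M * r)"
    by (auto intro!: eq_vecI)
  moreover have "E *\<^sub>v v @\<^sub>v ?D *\<^sub>v v = 0\<^sub>v c @\<^sub>v 0\<^sub>v (M * r) \<longleftrightarrow> E *\<^sub>v v = 0\<^sub>v c \<and> ?D *\<^sub>v v = 0\<^sub>v (M * r)"
    by (rule append_vec_eq[of _ c]) (use E in \<open>auto intro: mult_mat_vec_carrier[OF _ v]\<close>)
  ultimately have "nfold_mat M A *\<^sub>v v = 0\<^sub>v (c + M * r) \<longleftrightarrow> E *\<^sub>v v = 0\<^sub>v c \<and> ?D *\<^sub>v v = 0\<^sub>v (M * r)"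
    by (simp only:)
  also have "E *\<^sub>v v = 0\<^sub>v c \<longleftrightarrow> (\<forall>i < c. (\<Sum>j<M. brick c v j $ i) = 0)"
    using E Ev by (auto simp: vec_eq_iff)
  also have "?D *\<^sub>v v = 0\<^sub>v (M * r) \<longleftrightarrow> (\<forall>j < M. brick c v j \<in> mat_kernel A)"
    unfolding diag_block_mat_replicate_mult_eq_0_iff[OF A v] by (simp add: mat_kernel[OF A])
  finally show ?thesis
    using v by (auto simp: mat_kernel[OF nfold_mat_carrier[OF A]])
next
  case False
  then show ?thesis using mat_kernel_carrier[OF nfold_mat_carrier[OF A]] by blast
qed

section \<open>Graver bases\<close>

lemma graver_basisD:
  assumes "C \<in> carrier_mat d n" "v \<in> graver_basis C"
  shows "v \<in> mat_kernel C" "v \<in> carrier_vec n" "v \<noteq> 0\<^sub>v n"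
    "\<And>u. u \<in> mat_kernel C \<Longrightarrow> u \<noteq> 0\<^sub>v n \<Longrightarrow> u \<sqsubseteq>\<^sub>c v \<Longrightarrow> u = v"
  using assms mat_kernel_carrier[OF assms(1)] by (auto simp: graver_basis_def)

lemma graver_basisI:
  assumes "C \<in> carrier_mat d n" "v \<in> mat_kernel C" "v \<noteq> 0\<^sub>v n"
    "\<And>u. u \<in> mat_kernel C \<Longrightarrow> u \<noteq> 0\<^sub>v n \<Longrightarrow> u \<sqsubseteq>\<^sub>c v \<Longrightarrow> u = v"
  shows "v \<in> graver_basis C"
  using assms by (auto simp: graver_basis_def)

lemma mat_kernel_smult:
  assumes C: "C \<in> carrier_mat d n" and v: "v \<in> mat_kernel C"
  shows "(a :: int) \<cdot>\<^sub>v v \<in> mat_kernel C"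
proof (rule mat_kernelI[OF C])
  note vD = mat_kernelD[OF C v]
  show "a \<cdot>\<^sub>v v \<in> carrier_vec n" using vD by simp
  have "C *\<^sub>v (a \<cdot>\<^sub>v v) = a \<cdot>\<^sub>v (C *\<^sub>v v)"
    using C vD(1) by (intro eq_vecI) (auto simp: scalar_prod_smult_distrib)
  then show "C *\<^sub>v (a \<cdot>\<^sub>v v) = 0\<^sub>v d" using vD(2) by auto
qed

text \<open>Multiplication by a sign is an involution of the kernel that preserves the conformal
  order.\<close>

lemma graver_basis_smult_unit:
  assumes C: "C \<in> carrier_mat d n" and v: "v \<in> graver_basis C" and s: "\<bar>\<sigma>\<bar> = (1 :: int)"
  shows "\<sigma> \<cdot>\<^sub>v v \<in> graver_basis C"
proof -
  have ss: "\<sigma> * \<sigma> = 1" using s by (metis abs_mult_self_eq mult_1)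
  have zero: "\<sigma> \<cdot>\<^sub>v 0\<^sub>v n = 0\<^sub>v n" by auto
  have inv: "\<sigma> \<cdot>\<^sub>v (\<sigma> \<cdot>\<^sub>v u) = u" for u :: "int vec"
    by (simp add: smult_smult_assoc ss)
  note vD = graver_basisD[OF C v]
  show ?thesis
  proof (rule graver_basisI[OF C mat_kernel_smult[OF C vD(1)]])
    show "\<sigma> \<cdot>\<^sub>v v \<noteq> 0\<^sub>v n" using vD(3) inv[of v] by (metis zero)
    fix u assume u: "u \<in> mat_kernel C" "u \<noteq> 0\<^sub>v n" "u \<sqsubseteq>\<^sub>c \<sigma> \<cdot>\<^sub>v v"
    have "\<sigma> \<cdot>\<^sub>v u \<sqsubseteq>\<^sub>c v"
      using u(3) s by (auto simp: conformal_le_def abs_mult algebra_simps)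
    moreover have "\<sigma> \<cdot>\<^sub>v u \<noteq> 0\<^sub>v n" using u(2) inv[of u] by (metis zero)
    ultimately have "\<sigma> \<cdot>\<^sub>v u = v" using vD(4) mat_kernel_smult[OF C u(1)] by blast
    then show "u = \<sigma> \<cdot>\<^sub>v v" using inv by metis
  qed
qed

text \<open>Minimality ignores zero bricks and the order of the bricks: anything conformally below
  \<open>y\<close> vanishes outside the range of \<open>f\<close>, so it pulls back to something
  below \<open>x\<close>.\<close>

lemma graver_basis_nfold_embed:
  assumes A: "A \<in> carrier_mat r c" and x: "x \<in> graver_basis (nfold_mat M A)"
    and f: "inj_on f {..<M}" "f ` {..<M} \<subseteq> {..<N}"
    and y: "y \<in> carrier_vec (N * c)"
    and y_in: "\<And>j. j < M \<Longrightarrow> brick c y (f j) = brick c x j"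
    and y_out: "\<And>j. j < N \<Longrightarrow> j \<notin> f ` {..<M} \<Longrightarrow> brick c y j = 0\<^sub>v c"
  shows "y \<in> graver_basis (nfold_mat N A)"
proof -
  note C = nfold_mat_carrier[OF A]
  note xD = graver_basisD[OF C x]
  note ker = mat_kernel_nfold_iff[OF A]
  have z: "0\<^sub>v c \<in> mat_kernel A" using A by (intro mat_kernelI[OF A]) auto
  have fN: "f j < N" if "j < M" for j using f(2) that by auto
  have sum_f: "(\<Sum>j<N. brick c u j $ i) = (\<Sum>j<M. brick c u (f j) $ i)"
    if "\<And>j. j < N \<Longrightarrow> j \<notin> f ` {..<M} \<Longrightarrow> brick c u j = 0\<^sub>v c" "i < c" for u i
  proof -
    have "(\<Sum>j<N. brick c u j $ i) = (\<Sum>j\<in>f ` {..<M}. brick c u j $ i)"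
      using f(2) that by (intro sum.mono_neutral_right) (auto simp del: index_brick)
    also have "\<dots> = (\<Sum>j<M. brick c u (f j) $ i)"
      using f(1) by (simp add: sum.reindex)
    finally show ?thesis .
  qed
  show ?thesis
  proof (rule graver_basisI[OF C])
    have "brick c y j \<in> mat_kernel A" if "j < N" for j
    proof (cases "j \<in> f ` {..<M}")
      case True
      then show ?thesis using y_in xD(1) by (auto simp: ker)
    qed (use y_out that z in auto)
    moreover have "(\<Sum>j<N. brick c y j $ i) = 0" if "i < c" for i
      using xD(1) that sum_f[OF y_out that] y_in by (simp add: ker del: index_brick)
    ultimately show "y \<in> mat_kernel (nfold_mat N A)" using y by (simp add: ker)
    show "y \<noteq> 0\<^sub>v (N * c)"
    proof
      assume "y = 0\<^sub>v (N * c)"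
      then have "x = 0\<^sub>v (M * c)"
        using y_in fN by (intro eq_bricksI[OF xD(2)]) (auto simp: brick_zero simp flip: y_in)
      then show False using xD(3) by blast
    qed
    fix u assume u: "u \<in> mat_kernel (nfold_mat N A)" "u \<noteq> 0\<^sub>v (N * c)" "u \<sqsubseteq>\<^sub>c y"
    have uc: "u \<in> carrier_vec (N * c)" using u(1) ker by blast
    have le: "brick c u j \<sqsubseteq>\<^sub>c brick c y j" if "j < N" for j
      using u(3) that conformal_le_bricks_iff[OF uc y] by blast
    have u_out: "brick c u j = 0\<^sub>v c" if "j < N" "j \<notin> f ` {..<M}" for j
      using le[OF that(1)] y_out[OF that] by (auto simp: conformal_le_def vec_eq_iff)
    \<comment> \<open>The pullback of \<open>u\<close> along \<open>f\<close>, to which the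
      minimality of \<open>x\<close> applies.\<close>
    define w where "w = vec (M * c) (\<lambda>p. u $ (f (p div c) * c + p mod c))"
    have w: "w \<in> carrier_vec (M * c)" by (simp add: w_def)
    have bw: "brick c w j = brick c u (f j)" if "j < M" for j
      using that by (auto simp: w_def brick_index_less)
    have "w \<in> mat_kernel (nfold_mat M A)"
      using u(1) sum_f[OF u_out] w fN by (simp add: ker bw del: index_brick)
    moreover have "w \<noteq> 0\<^sub>v (M * c)"
    proof
      assume w0: "w = 0\<^sub>v (M * c)"
      have "brick c u j = 0\<^sub>v c" if "j < N" for j
      proof (cases "j \<in> f ` {..<M}")
        case True
        then show ?thesis using bw w0 brick_zero by auto
      qed (use u_out that in auto)
      then have "u = 0\<^sub>v (N * c)"
        by (intro eq_bricksI[OF uc]) (auto simp: brick_zero)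
      then show False using u(2) by blast
    qed
    moreover have "w \<sqsubseteq>\<^sub>c x"
      unfolding conformal_le_bricks_iff[OF w xD(2)] using le fN by (simp add: bw flip: y_in)
    ultimately have "w = x" by (rule xD(4))
    show "u = y"
    proof (rule eq_bricksI[OF uc y])
      fix j assume j: "j < N"
      show "brick c u j = brick c y j"
      proof (cases "j \<in> f ` {..<M}")
        case True
        then show ?thesis using bw y_in \<open>w = x\<close> by auto
      qed (use u_out y_out j in auto)
    qed
  qed
qed

text \<open>Brick \<open>m\<close> of an \<open>M\<close>-brick vector is moved to a new last brick; for \<open>m = M\<close> the vector is
  only padded with a zero brick.\<close>

definition move_brick :: "nat \<Rightarrow> nat \<Rightarrow> nat \<Rightarrow> int vec \<Rightarrow> int vec" where
  "move_brick c M m x = vec (Suc M * c) (\<lambda>p.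
     if p div c = m then 0 else if p div c = M then x $ (m * c + p mod c) else x $ p)"

lemma brick_move_brick:
  assumes "j \<le> M"
  shows "brick c (move_brick c M m x) j =
    (if j = m then 0\<^sub>v c else if j = M then brick c x m else brick c x j)"
  using assms brick_index_less[of j "Suc M" _ c] by (auto simp: move_brick_def)

lemma move_brick_carrier: "move_brick c M m x \<in> carrier_vec (Suc M * c)"
  by (simp add: move_brick_def)

lemma graver_basis_move_brick:
  assumes A: "A \<in> carrier_mat r c" and x: "x \<in> graver_basis (nfold_mat M A)" and "m \<le> M"
  shows "move_brick c M m x \<in> graver_basis (nfold_mat (Suc M) A)"
proof (rule graver_basis_nfold_embed[OF A x, where f = "\<lambda>j. if j = m then M else j"])
  show "inj_on (\<lambda>j. if j = m then M else j) {..<M}" by (auto simp: inj_on_def)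
  fix j assume "j < Suc M" "j \<notin> (\<lambda>j. if j = m then M else j) ` {..<M}"
  then show "brick c (move_brick c M m x) j = 0\<^sub>v c"
    using \<open>m \<le> M\<close> by (auto simp: brick_move_brick image_iff split: if_splits)
qed (use \<open>m \<le> M\<close> in \<open>auto simp: brick_move_brick simp del: mult_Suc intro: move_brick_carrier\<close>)

text \<open>Repeating each vector \<open>h i\<close> times, as bricks, turns a positive primitive relation on Graver
  basis elements into a single Graver basis element of the higher N-fold matrix: a conformal
  summand selects a sub-multiset of the bricks, which is a relation that primitivity forces to be
  trivial or everything.\<close>

lemma primitive_relation_le_graver_complexity:
  assumes C: "C \<in> carrier_mat d n" and y: "\<And>i. i \<in> I \<Longrightarrow> y i \<in> graver_basis C"
    and P: "primitive_relation n I h y" and h: "\<And>i. i \<in> I \<Longrightarrow> h i > 0"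
  shows "enat (nat (\<Sum>i\<in>I. h i)) \<le> graver_complexity C"
proof (cases "I = {}")
  case True
  then show ?thesis by (simp flip: zero_enat_def)
next
  case ne: False
  have fin: "finite I" and rel: "linear_relation n I h y" using P by (auto simp: primitive_relation_def)
  note yD = graver_basisD[OF C y]
  have yc: "y \<in> I \<rightarrow> carrier_vec n" using yD(2) by blast
  \<comment> \<open>One element for each of the \<open>h i\<close> copies of \<open>y i\<close>. The
    bijection \<open>e\<close> enumerates the copies, and \<open>\<iota> j\<close> tells which
    vector fills brick \<open>j\<close>.\<close>
  define S where "S = (SIGMA i:I. {..<nat (h i)})"
  define N where "N = card S"
  have finS: "finite S" using fin by (simp add: S_def)
  obtain e where e: "bij_betw e {..<N} S"
    using ex_bij_betw_nat_finite[OF finS] by (auto simp: N_def atLeast0LessThan)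
  define \<iota> where "\<iota> = fst \<circ> e"
  have \<iota>: "\<iota> j \<in> I" if "j < N" for j
    using bij_betw_apply[OF e, of j] that by (auto simp: \<iota>_def S_def)
  have sum_\<iota>: "(\<Sum>j<N. F (\<iota> j)) = (\<Sum>i\<in>I. h i * F i)" for F :: "_ \<Rightarrow> int"
  proof -
    have "(\<Sum>j<N. F (\<iota> j)) = (\<Sum>z\<in>S. F (fst z))"
      using sum.reindex_bij_betw[OF e, of "\<lambda>z. F (fst z)"] by (simp add: \<iota>_def)
    also have "\<dots> = (\<Sum>i\<in>I. \<Sum>q<nat (h i). F i)"
      using fin unfolding S_def by (subst sum.Sigma) (auto simp: case_prod_beta)
    also have "\<dots> = (\<Sum>i\<in>I. h i * F i)"
      by (rule sum.cong) (use h in \<open>auto intro: less_imp_le\<close>)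
    finally show ?thesis .
  qed
  have N: "int N = (\<Sum>i\<in>I. h i)" using sum_\<iota>[of "\<lambda>_. 1"] by simp
  have "(\<Sum>i\<in>I. h i) > 0" using h fin ne by (intro sum_pos) auto
  then have N1: "N \<ge> 1" using N by linarith
  define X where "X = vec (N * n) (\<lambda>p. y (\<iota> (p div n)) $ (p mod n))"
  have X: "X \<in> carrier_vec (N * n)" by (simp add: X_def)
  have bX: "brick n X j = y (\<iota> j)" if "j < N" for j
    using yD(2)[OF \<iota>[OF that]] that by (auto simp: X_def brick_index_less)
  note ker = mat_kernel_nfold_iff[OF C]
  note CN = nfold_mat_carrier[OF C, of N]
  have "X \<in> graver_basis (nfold_mat N C)"
  proof (rule graver_basisI[OF CN])
    have "(\<Sum>i\<in>I. h i * y i $ p) = 0" if "p < n" for p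
      using rel that linear_relation_iff[OF fin yc] by blast
    then show "X \<in> mat_kernel (nfold_mat N C)"
      using X yD(1) \<iota> sum_\<iota>[of "\<lambda>i. y i $ p" for p] by (simp add: ker bX del: index_brick)
    show "X \<noteq> 0\<^sub>v (N * n)"
      using bX[of 0] brick_zero[of 0 N n] yD(3)[OF \<iota>, of 0] N1 by auto
    fix u assume u: "u \<in> mat_kernel (nfold_mat N C)" "u \<noteq> 0\<^sub>v (N * n)" "u \<sqsubseteq>\<^sub>c X"
    have uc: "u \<in> carrier_vec (N * n)" using u(1) ker by blast
    \<comment> \<open>Each nonzero brick of \<open>u\<close> is a kernel element conformally below a
      Graver basis element, hence equal to it. So \<open>u\<close> merely selects the bricks in
      \<open>T\<close>.\<close>
    define T where "T = {j. j < N \<and> brick n u j \<noteq> 0\<^sub>v n}"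
    have T: "T \<subseteq> {..<N}" "finite T" by (auto simp: T_def)
    have uT: "brick n u j = y (\<iota> j)" if "j \<in> T" for j
    proof (rule yD(4)[OF \<iota>])
      show "brick n u j \<sqsubseteq>\<^sub>c y (\<iota> j)"
        using u(3) that bX conformal_le_bricks_iff[OF uc X] by (auto simp: T_def)
    qed (use that u(1) in \<open>auto simp: T_def ker\<close>)
    have "T \<noteq> {}"
    proof
      assume "T = {}"
      then have "u = 0\<^sub>v (N * n)"
        by (intro eq_bricksI[OF uc]) (auto simp: T_def brick_zero)
      then show False using u(2) by blast
    qed
    \<comment> \<open>The multiplicity of each vector in the selection; these numbers form a
      relation because the bricks of \<open>u\<close> sum to zero.\<close>
    define a where "a i = int (card {j \<in> T. \<iota> j = i})" for i
    have sum_a: "(\<Sum>i\<in>I. a i * F i) = (\<Sum>j\<in>T. F (\<iota> j))" for F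
    proof -
      have "(\<Sum>j\<in>T. F (\<iota> j)) = (\<Sum>i\<in>I. \<Sum>j\<in>{j \<in> T. \<iota> j = i}. F (\<iota> j))"
        using T fin \<iota> by (intro sum.group[symmetric]) auto
      also have "\<dots> = (\<Sum>i\<in>I. a i * F i)"
        by (rule sum.cong) (auto simp: a_def)
      finally show ?thesis by simp
    qed
    have "(\<Sum>i\<in>I. a i * y i $ p) = 0" if "p < n" for p
    proof -
      have "(\<Sum>i\<in>I. a i * y i $ p) = (\<Sum>j\<in>T. brick n u j $ p)"
        unfolding sum_a by (rule sum.cong) (auto simp: uT simp del: index_brick)
      also have "\<dots> = (\<Sum>j<N. brick n u j $ p)"
        using that T(1) by (intro sum.mono_neutral_left) (auto simp: T_def simp del: index_brick)
      also have "\<dots> = 0" using u(1) that by (auto simp: ker)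
      finally show ?thesis .
    qed
    then have "linear_relation n I a y"
      using linear_relation_iff[OF fin yc] by blast
    then obtain t where t: "\<And>i. i \<in> I \<Longrightarrow> a i = t * h i"
      using primitive_relation_multiple[OF P] by blast
    \<comment> \<open>The size of the selection is a positive multiple of \<open>N\<close>, so every
      brick is selected.\<close>
    have cT: "int (card T) = t * int N"
      using sum_a[of "\<lambda>_. 1"] t by (simp add: N sum_distrib_left)
    moreover have "card T > 0" using \<open>T \<noteq> {}\<close> T(2) by (simp add: card_gt_0_iff)
    ultimately have "t * int N > 0" by linarith
    then have "t \<ge> 1" using zero_less_mult_pos2[of t "int N"] N1 by simp
    then have "int N \<le> t * int N" using mult_right_mono[of 1 t "int N"] by simp
    then have "card T \<ge> N" using cT by linarith
    then have "T = {..<N}" using T(1) by (intro card_seteq) auto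
    then show "u = X" using uT bX by (intro eq_bricksI[OF uc X]) auto
  qed
  moreover have "brick_type n N X = N"
  proof -
    have "{j. j < N \<and> brick n X j \<noteq> 0\<^sub>v n} = {..<N}"
      using bX yD(3)[OF \<iota>] by auto
    then show ?thesis by (simp add: brick_type_def)
  qed
  moreover have "dim_col C = n" using C by auto
  ultimately have "N \<in> graver_types C"
    unfolding graver_types_def using N1 by (intro CollectI exI[of _ N] exI[of _ X]) auto
  then have "enat N \<le> graver_complexity C"
    unfolding graver_complexity_def by (rule SUP_upper)
  then show ?thesis by (simp flip: N)
qed

section \<open>The extended relation\<close>

theorem theorem1:
  fixes A :: "int mat" and r c M k g l :: nat and s :: int
    and h :: "nat \<Rightarrow> int" and x b :: "nat \<Rightarrow> int vec"
  assumes A: "A \<in> carrier_mat r c"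
    and x_graver: "\<forall>i \<in> {0..k}. x i \<in> graver_basis (nfold_mat M A)"
    and h_pos: "\<forall>i \<in> {0..k}. h i > 0"
    and prim: "primitive_relation (M * c) {0..k} h x"
    and g_def: "g = brick_type c M (x 0)" and g_gt_2: "g > 2"
    and a_first: "\<forall>j < g - 1. brick c (x 0) j = b j"
    and a_zero: "\<forall>j. g - 1 \<le> j \<and> j < M - 1 \<longrightarrow> brick c (x 0) j = 0\<^sub>v c"
    and a_last: "brick c (x 0) (M - 1) = b (g - 1)"
    and a_prim: "primitive_relation c {0..<g} (\<lambda>_. 1) b"
    and l_le_k: "l \<le> k"
    and b_last: "\<forall>i \<in> {1..l}. brick c (x i) (M - 1) = - b (g - 1)"
    and c_sum: "h 0 + s = (\<Sum>i = 1..l. h i)"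
    and c_gcd: "gcd (int g - 1) s = 1"
  shows "let q = (if s \<ge> 0 then (int g - 1) * (\<Sum>i = 0..k. h i) + (2 * int g - 3) * s
                  else (int g - 1) * (\<Sum>i = 0..k. h i) - s)
         in (\<exists>(h' :: nat \<Rightarrow> int) (y :: nat \<Rightarrow> int vec).
               primitive_relation ((M + 1) * c) {0..k + g - 1} h' y \<and>
               (\<forall>i \<in> {0..k + g - 1}. y i \<in> graver_basis (nfold_mat (M + 1) A)) \<and>
               (\<Sum>i = 0..k + g - 1. h' i) = q) \<and>
            enat (nat q) \<le> graver_complexity (nfold_mat (M + 1) A)"
proof -

  \<comment> \<open>Choice of the vectors and coefficients\<close>
  define I where "I = {0..k + g - 1}"
  \<comment> \<open>Chosen so that \<open>\<sigma> * \<bar>s\<bar> = - s\<close>.\<close>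
  define \<sigma> :: int where "\<sigma> = (if s \<ge> 0 then -1 else 1)"
  \<comment> \<open>Positions start at \<open>0\<close>: \<open>M - 1\<close> is the old last brick
    and \<open>M\<close> the new one. In the last case \<open>m = i - Suc k\<close> runs from
    \<open>0\<close> to \<open>g - 2\<close>.\<close>
  define y where "y i =
    (if i \<le> l then move_brick c M (M - 1) (x i) else if i \<le> k then move_brick c M M (x i)
     else \<sigma> \<cdot>\<^sub>v move_brick c M (i - Suc k) (x 0))" for i
  \<comment> \<open>The solution for \<open>t = g - 1\<close> and \<open>\<tau> = - s\<close>: then
    \<open>h' 0 + (g - 2) * \<tau>\<close> has to be \<open>(g - 1) * h 0\<close>.\<close>
  define h' where "h' i =
    (if i = 0 then (int g - 1) * h 0 + (int g - 2) * s else if i \<le> k then (int g - 1) * h i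
     else \<bar>s\<bar>)" for i
  note [simp del] = index_brick
  have \<sigma>: "\<bar>\<sigma>\<bar> = 1" "\<sigma> * \<sigma> = 1" "\<sigma> * \<bar>s\<bar> = - s" by (auto simp: \<sigma>_def)
  note C = nfold_mat_carrier[OF A]
  have x: "x \<in> {0..k} \<rightarrow> carrier_vec (M * c)"
    using x_graver graver_basisD(2)[OF C] by blast
  have b: "b \<in> {0..<g} \<rightarrow> carrier_vec c"
    using a_prim unfolding primitive_relation_def by blast
  have sum_b: "(\<Sum>m<g. b m $ q) = 0" if "q < c" for q
    using a_prim that linear_relation_iff[OF _ b]
    by (simp add: primitive_relation_def atLeast0LessThan)
  have b_nz: "b m \<noteq> 0\<^sub>v c" if "m < g" for m
  proof
    assume "b m = 0\<^sub>v c"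
    then have "linear_relation c {0..<g} (\<lambda>i. if i = m then 1 else 0) b"
      by (subst linear_relation_iff[OF _ b]) (auto intro!: sum.neutral)
    then obtain t where t: "\<And>i. i \<in> {0..<g} \<Longrightarrow> (if i = m then 1 else 0) = t * (1 :: int)"
      using primitive_relation_multiple[OF a_prim] by blast
    obtain m' where "m' < g" "m' \<noteq> m"
      using g_gt_2 by (metis less_trans one_less_numeral_iff semiring_norm(76) zero_less_numeral zero_neq_one)
    then show False using t[of m] t[of m'] that by auto
  qed
  \<comment> \<open>Keeps every moved position \<open>m < g - 1\<close> strictly below the old last
    position \<open>M - 1\<close>.\<close>
  have gM: "g \<le> M"
  proof -
    have sub: "{j. j < M \<and> brick c (x 0) j \<noteq> 0\<^sub>v c} \<subseteq> insert (M - 1) {..<g - 1} \<inter> {..<M}"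
    proof
      fix j assume j: "j \<in> {j. j < M \<and> brick c (x 0) j \<noteq> 0\<^sub>v c}"
      then have "\<not> (g - 1 \<le> j \<and> j < M - 1)" using a_zero by blast
      then show "j \<in> insert (M - 1) {..<g - 1} \<inter> {..<M}" using j by auto
    qed
    have "g \<le> card (insert (M - 1) {..<g - 1} \<inter> {..<M})"
      unfolding g_def brick_type_def by (rule card_mono[OF _ sub[unfolded g_def brick_type_def]]) auto
    also have "\<dots> \<le> card {..<M}" by (rule card_mono) auto
    finally show ?thesis by simp
  qed
  have h0s: "h 0 + s \<ge> 0"
    unfolding c_sum using h_pos l_le_k by (intro sum_nonneg) (auto intro: less_imp_le)

  have sum_k: "(\<Sum>i = 0..k. F i) = F 0 + (\<Sum>i = 1..l. F i) + (\<Sum>i = Suc l..k. F i)"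
    for F :: "nat \<Rightarrow> int"
    using sum.ub_add_nat[of 1 l F "k - l"] l_le_k by (simp add: sum.atLeast_Suc_atMost)
  have sum_I: "(\<Sum>i\<in>I. F i) = (\<Sum>i = 0..k. F i) + (\<Sum>m<g - 1. F (Suc k + m))"
    for F :: "nat \<Rightarrow> int"
  proof -
    have "(\<Sum>m<g - 1. F (Suc k + m)) = (\<Sum>i = k + 1..k + (g - 1). F i)"
      by (rule sum.reindex_bij_witness[of _ "\<lambda>i. i - Suc k" "\<lambda>m. Suc k + m"]) auto
    then show ?thesis
      using sum.ub_add_nat[of 0 k F "g - 1"] g_gt_2 by (simp add: I_def)
  qed

  \<comment> \<open>Graver basis membership and entries of the new vectors\<close>
  have y_graver: "y i \<in> graver_basis (nfold_mat (Suc M) A)" if "i \<in> I" for i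
  proof (cases "i \<le> k")
    case True
    then show ?thesis
      using x_graver by (auto simp: y_def intro!: graver_basis_move_brick[OF A])
  next
    case False
    then have "i - Suc k \<le> M" using that gM by (auto simp: I_def)
    then show ?thesis
      using False l_le_k x_graver \<sigma>(1)
      by (auto simp: y_def intro!: graver_basis_smult_unit[OF C] graver_basis_move_brick[OF A])
  qed
  have y: "y \<in> I \<rightarrow> carrier_vec (Suc M * c)"
    using y_graver graver_basisD(2)[OF C] by blast

  have x_last: "brick c (x i) (M - 1) $ q = - b (g - 1) $ q" if "i \<in> {1..l}" "q < c" for i q
  proof -
    have "dim_vec (b (g - 1)) = c" using b g_gt_2 by (simp add: Pi_iff)
    then show ?thesis using b_last that by auto
  qed
  have y1: "brick c (y i) j $ q =
      (if j = M - 1 then 0 else if j = M then brick c (x i) (M - 1) $ q else brick c (x i) j $ q)"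
    if "i \<le> l" "j \<le> M" "q < c" for i j q
    using that by (simp add: y_def brick_move_brick)
  have y2: "brick c (y i) j $ q = (if j = M then 0 else brick c (x i) j $ q)"
    if "l < i" "i \<le> k" "j \<le> M" "q < c" for i j q
    using that by (simp add: y_def brick_move_brick)
  have y3: "brick c (y (Suc k + m)) j $ q =
      \<sigma> * (if j = m then 0 else if j = M then b m $ q else brick c (x 0) j $ q)"
    if "m < g - 1" "j \<le> M" "q < c" for m j q
  proof -
    have "brick c (y (Suc k + m)) j $ q = \<sigma> * brick c (move_brick c M m (x 0)) j $ q"
      using that l_le_k brick_index_less[of j "Suc M" q c] move_brick_carrier[of c M m "x 0"]
      by (auto simp: y_def index_brick simp del: mult_Suc)
    then show ?thesis using that a_first by (simp add: brick_move_brick)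
  qed

  \<comment> \<open>Comparison of relations among the \<open>y i\<close> and among the
    \<open>x i\<close>, brick by brick\<close>
  have top: "(\<Sum>i\<in>I. a i * brick c (y i) M $ q) =
      (\<Sum>m<g - 1. \<sigma> * a (Suc k + m) * b m $ q) + (a 0 - (\<Sum>i = 1..l. a i)) * b (g - 1) $ q"
    if q: "q < c" for a q
  proof -
    \<comment> \<open>By (b) the bricks moved here from \<open>x 1, ..., x l\<close> are copies of
      \<open>- b (g - 1)\<close>, so their coefficients count against \<open>a 0\<close>.\<close>
    have "(\<Sum>i = 1..l. a i * brick c (y i) M $ q) = - (\<Sum>i = 1..l. a i) * b (g - 1) $ q"
      unfolding sum_distrib_right minus_mult_left [symmetric] sum_negf [symmetric]
      by (rule sum.cong) (use q gM g_gt_2 x_last in \<open>auto simp: y1\<close>)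
    moreover have "(\<Sum>i = Suc l..k. a i * brick c (y i) M $ q) = 0"
      by (rule sum.neutral) (use q in \<open>auto simp: y2\<close>)
    moreover have "(\<Sum>m<g - 1. a (Suc k + m) * brick c (y (Suc k + m)) M $ q) =
        (\<Sum>m<g - 1. \<sigma> * a (Suc k + m) * b m $ q)"
      by (rule sum.cong) (use q gM in \<open>auto simp only: y3 le_refl lessThan_iff mult_ac split: if_splits\<close>)
    moreover have "brick c (y 0) M $ q = b (g - 1) $ q"
      using q gM g_gt_2 a_last by (simp add: y1)
    ultimately show ?thesis
      unfolding sum_I sum_k by (simp add: left_diff_distrib)
  qed

  \<comment> \<open>A brick \<open>j < g - 1\<close> of \<open>x 0\<close> survives in all but one
    of the \<open>g - 1\<close> vectors made from \<open>x 0\<close>; with common signed coefficient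
    \<open>\<tau>\<close> these add \<open>(g - 2) * \<tau>\<close> to the coefficient of
    \<open>x 0\<close>.\<close>
  define a' where "a' \<tau> a i = (if i = 0 then a 0 + (int g - 2) * \<tau> else a i)"
    for \<tau> and a :: "nat \<Rightarrow> int" and i :: nat
  have low: "(\<Sum>i\<in>I. a i * brick c (y i) j $ q) = (\<Sum>i = 0..k. a' \<tau> a i * brick c (x i) j $ q)"
    if \<tau>: "\<And>m. m < g - 1 \<Longrightarrow> \<sigma> * a (Suc k + m) = \<tau>" "a 0 - (\<Sum>i = 1..l. a i) = \<tau>"
      and j: "j < M" and q: "q < c" for a \<tau> j q
  proof -
    let ?X = "\<lambda>i. brick c (x i) j $ q"
    have s3: "(\<Sum>m<g - 1. a (Suc k + m) * brick c (y (Suc k + m)) j $ q) =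
        (\<Sum>m<g - 1. if m = j then 0 else \<tau> * ?X 0)"
      by (rule sum.cong) (use q j \<tau>(1) y3 in \<open>auto simp: algebra_simps\<close>)
    have s2: "(\<Sum>i = Suc l..k. a i * brick c (y i) j $ q) = (\<Sum>i = Suc l..k. a i * ?X i)"
      by (rule sum.cong) (use q j in \<open>auto simp: y2\<close>)
    have a'_sums: "(\<Sum>i = 0..k. a' \<tau> a i * ?X i) =
        (a 0 + (int g - 2) * \<tau>) * ?X 0 + (\<Sum>i = 1..l. a i * ?X i) + (\<Sum>i = Suc l..k. a i * ?X i)"
      unfolding sum_k by (simp add: a'_def)
    show ?thesis
    proof (cases "j = M - 1")
      \<comment> \<open>At the old last brick \<open>y 0, ..., y l\<close> vanish, while the
        \<open>g - 1\<close> extra vectors keep theirs. Apart from the indices above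
        \<open>l\<close> up to \<open>k\<close>, both sides equal
        \<open>(g - 1) * \<tau> * b (g - 1) $ q\<close>.\<close>
      case True
      have "(\<Sum>i = 1..l. a i * ?X i) = - (\<Sum>i = 1..l. a i) * b (g - 1) $ q"
        unfolding sum_distrib_right minus_mult_left [symmetric] sum_negf [symmetric]
        by (rule sum.cong) (use q x_last True in auto)
      moreover have "(\<Sum>i = 1..l. a i * brick c (y i) j $ q) = 0"
        by (rule sum.neutral) (use q j True in \<open>auto simp: y1\<close>)
      moreover have "(\<Sum>m<g - 1. if m = j then 0 else \<tau> * ?X 0) = (int g - 1) * (\<tau> * ?X 0)"
      proof -
        have "(\<Sum>m<g - 1. if m = j then 0 else \<tau> * ?X 0) = (\<Sum>m<g - 1. \<tau> * ?X 0)"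
          by (rule sum.cong) (use gM True in auto)
        then show ?thesis using g_gt_2 by (simp add: of_nat_diff)
      qed
      moreover have "brick c (y 0) j $ q = 0" using q j True by (simp add: y1)
      moreover have "?X 0 = b (g - 1) $ q" using a_last True by simp
      moreover have "a 0 = \<tau> + (\<Sum>i = 1..l. a i)" using \<tau>(2) by simp
      ultimately show ?thesis
        unfolding sum_I s3 a'_sums sum_k s2 by (simp add: algebra_simps)
    next
      case False
      have "(\<Sum>i = 1..l. a i * brick c (y i) j $ q) = (\<Sum>i = 1..l. a i * ?X i)"
        by (rule sum.cong) (use q j False in \<open>auto simp: y1\<close>)
      moreover have "brick c (y 0) j $ q = ?X 0" using q j False by (simp add: y1)
      \<comment> \<open>Below \<open>g - 1\<close> exactly one extra vector has lost brick
        \<open>j\<close>; from \<open>g - 1\<close> to \<open>M - 2\<close> this brick of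
        \<open>x 0\<close> is zero anyway.\<close>
      moreover have "(\<Sum>m<g - 1. if m = j then 0 else \<tau> * ?X 0) = (int g - 2) * \<tau> * ?X 0"
      proof (cases "j < g - 1")
        case True
        have "(\<Sum>m<g - 1. if m = j then 0 else \<tau> * ?X 0) = (\<Sum>m\<in>{..<g - 1} - {j}. \<tau> * ?X 0)"
          by (rule sum.mono_neutral_cong_right) auto
        then show ?thesis using True g_gt_2 by (simp add: of_nat_diff)
      next
        case ge: False
        then have "?X 0 = 0" using a_zero False j q by simp
        then show ?thesis by (simp cong: if_cong)
      qed
      ultimately show ?thesis
        unfolding sum_I s3 a'_sums sum_k s2 by (simp add: algebra_simps)
    qed
  qed

  have rel_iff: "linear_relation (Suc M * c) I a y \<longleftrightarrow> linear_relation (M * c) {0..k} (a' \<tau> a) x"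
    if \<tau>: "\<And>m. m < g - 1 \<Longrightarrow> \<sigma> * a (Suc k + m) = \<tau>" "a 0 - (\<Sum>i = 1..l. a i) = \<tau>" for a \<tau>
  proof -
    \<comment> \<open>With equal coefficients the new brick imposes no further condition, since the
      \<open>b m\<close> sum to zero.\<close>
    have "(\<Sum>i\<in>I. a i * brick c (y i) M $ q) = 0" if "q < c" for q
    proof -
      have "(\<Sum>i\<in>I. a i * brick c (y i) M $ q) = (\<Sum>m<g - 1. \<tau> * b m $ q) + \<tau> * b (g - 1) $ q"
        using \<tau> by (simp add: top[OF that])
      also have "\<dots> = \<tau> * (\<Sum>m<Suc (g - 1). b m $ q)"
        by (simp add: sum_distrib_left distrib_left)
      finally show ?thesis using sum_b[OF that] g_gt_2 by simp
    qed
    then show ?thesis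
      using low[of a \<tau>, OF \<tau>] x y unfolding I_def
      by (simp add: linear_relation_bricks_iff less_Suc_eq all_conj_distrib del: mult_Suc)
  qed

  have rel_const: "\<exists>\<tau>. (\<forall>m < g - 1. \<sigma> * a (Suc k + m) = \<tau>) \<and> a 0 - (\<Sum>i = 1..l. a i) = \<tau>"
    if R: "linear_relation (Suc M * c) I a y" for a
  proof -
    \<comment> \<open>The coefficients of the \<open>b m\<close> in the new brick, by
      \<open>top\<close>. The index \<open>g - 1\<close> gathers \<open>x 0, ..., x l\<close>, whose
      last bricks are \<open>b (g - 1)\<close> up to sign.\<close>
    define \<beta> where "\<beta> m = (if m < g - 1 then \<sigma> * a (Suc k + m) else a 0 - (\<Sum>i = 1..l. a i))" for m
    have "(\<Sum>m\<in>{0..<g}. \<beta> m * b m $ q) = 0" if q: "q < c" for q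
    proof -
      have "(\<Sum>m\<in>{0..<g}. \<beta> m * b m $ q) = (\<Sum>m<Suc (g - 1). \<beta> m * b m $ q)"
        using g_gt_2 by (simp add: atLeast0LessThan del: sum.lessThan_Suc)
      also have "\<dots> = (\<Sum>i\<in>I. a i * brick c (y i) M $ q)"
        by (simp add: \<beta>_def top[OF q])
      also have "\<dots> = 0"
        using R q y linear_relation_bricks_iff[of I y "Suc M" c a]
        by (simp add: I_def del: mult_Suc)
      finally show ?thesis .
    qed
    then have "linear_relation c {0..<g} \<beta> b"
      by (subst linear_relation_iff[OF _ b]) auto
    then obtain t where "\<And>m. m \<in> {0..<g} \<Longrightarrow> \<beta> m = t * 1"
      using primitive_relation_multiple[OF a_prim] by blast
    then have t: "\<beta> m = t" if "m < g" for m using that by simp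
    have "\<sigma> * a (Suc k + m) = t" if "m < g - 1" for m
      using t[of m] that by (simp add: \<beta>_def)
    moreover have "a 0 - (\<Sum>i = 1..l. a i) = t"
      using t[of "g - 1"] g_gt_2 by (simp add: \<beta>_def)
    ultimately show ?thesis by blast
  qed

  \<comment> \<open>Positivity, relation property and coprimality of the coefficients
    \<open>h'\<close>\<close>
  have s_nz: "s \<noteq> 0" using c_gcd g_gt_2 by auto
  have h'0_pos: "h' 0 > 0"
  proof -
    \<comment> \<open>This form settles negative \<open>s\<close> too, because
      \<open>h 0 + s\<close> is a sum of positive coefficients.\<close>
    have "h' 0 = h 0 + (int g - 2) * (h 0 + s)" by (simp add: h'_def algebra_simps)
    moreover have "(int g - 2) * (h 0 + s) \<ge> 0" using h0s g_gt_2 by simp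
    moreover have "h 0 > 0" using h_pos by simp
    ultimately show ?thesis by linarith
  qed
  have h'_pos: "h' i > 0" for i
  proof (cases "i = 0 \<or> i > k")
    case True
    then show ?thesis using h'0_pos s_nz by (auto simp: h'_def)
  next
    case False
    then show ?thesis using h_pos g_gt_2 by (simp add: h'_def)
  qed

  have h'_rel: "linear_relation (Suc M * c) I h' y"
  proof -
    have sum_h': "(\<Sum>i = 1..l. h' i) = (int g - 1) * (h 0 + s)"
      unfolding c_sum sum_distrib_left by (rule sum.cong) (use l_le_k in \<open>auto simp: h'_def\<close>)
    have "linear_relation (M * c) {0..k} (a' (- s) h') x"
    proof -
      have eq: "a' (- s) h' i = (int g - 1) * h i" if "i \<in> {0..k}" for i
        using that by (simp add: a'_def h'_def)
      have "(\<Sum>i = 0..k. a' (- s) h' i * x i $ p) = (int g - 1) * (\<Sum>i = 0..k. h i * x i $ p)" for p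
        unfolding sum_distrib_left by (rule sum.cong) (auto simp: eq)
      moreover have "linear_relation (M * c) {0..k} h x" using prim by (simp add: primitive_relation_def)
      ultimately show ?thesis using x by (simp add: linear_relation_iff)
    qed
    then show ?thesis
    proof (subst rel_iff[where \<tau> = "- s"])
      show "\<sigma> * h' (Suc k + m) = - s" for m by (simp add: h'_def \<sigma>(3))
      show "h' 0 - (\<Sum>i = 1..l. h' i) = - s"
        unfolding sum_h' by (simp add: h'_def algebra_simps)
    qed
  qed

  have h'_Gcd: "Gcd (h' ` I) = 1"
  proof -
    let ?d = "Gcd (h' ` I)"
    have d: "?d dvd h' i" if "i \<in> I" for i using that by simp
    \<comment> \<open>The coefficient at \<open>Suc k\<close> is \<open>\<bar>s\<bar>\<close>. So a
      common divisor divides \<open>s\<close> and is coprime to \<open>g - 1\<close>, whence it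
      divides every \<open>h i\<close>.\<close>
    have "Suc k \<in> I" using g_gt_2 by (auto simp: I_def)
    then have ds: "?d dvd s" using d[of "Suc k"] by (simp add: h'_def)
    have "coprime (int g - 1) s" using c_gcd by (simp add: coprime_iff_gcd_eq_1)
    then have cop: "coprime ?d (int g - 1)"
      using ds by (meson coprime_commute coprime_divisors dvd_refl)
    have "?d dvd h i" if "i \<in> {0..k}" for i
    proof -
      have "?d dvd h' i" using that d g_gt_2 by (auto simp: I_def)
      then have "?d dvd (int g - 1) * h i"
        using ds that by (cases "i = 0") (auto simp: h'_def dvd_add_left_iff)
      then show ?thesis using cop by (simp add: coprime_dvd_mult_right_iff)
    qed
    then have "?d dvd Gcd (h ` {0..k})" by (auto intro!: Gcd_greatest)
    then show ?thesis using prim by (simp add: primitive_relation_def)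
  qed

  \<comment> \<open>Primitivity of the extended relation\<close>
  have y_prim: "primitive_relation (Suc M * c) I h' y"
  proof (rule primitive_relationI[OF _ y h'_rel _ h'_Gcd])
    show "finite I" by (simp add: I_def)
    show "h' i \<noteq> 0" for i using h'_pos[of i] by simp
    fix a i j assume R: "linear_relation (Suc M * c) I a y" and j: "j \<in> I" "a j = 0" and i: "i \<in> I"
    obtain \<tau> where \<tau>: "\<And>m. m < g - 1 \<Longrightarrow> \<sigma> * a (Suc k + m) = \<tau>" "a 0 - (\<Sum>i = 1..l. a i) = \<tau>"
      using rel_const[OF R] by blast
    have "linear_relation (M * c) {0..k} (a' \<tau> a) x" using R rel_iff[of a \<tau>, OF \<tau>] by blast
    then obtain t where t: "\<And>i. i \<in> {0..k} \<Longrightarrow> a' \<tau> a i = t * h i"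
      using primitive_relation_multiple[OF prim] by blast
    have t_pos: "a i = t * h i" if "i \<in> {1..k}" for i using t[of i] that by (simp add: a'_def)
    have t0: "a 0 + (int g - 2) * \<tau> = t * h 0" using t[of 0] by (simp add: a'_def)
    have "(\<Sum>i = 1..l. a i) = t * (h 0 + s)"
      unfolding c_sum sum_distrib_left by (rule sum.cong) (use t_pos l_le_k in auto)
    then have \<tau>s: "a 0 - t * (h 0 + s) = \<tau>" using \<tau>(2) by simp
    \<comment> \<open>Eliminating \<open>a 0\<close> ties \<open>\<tau>\<close> to \<open>t\<close>,
      so that \<open>t\<close> alone determines the relation.\<close>
    have gs: "(int g - 1) * \<tau> = - (t * s)" using t0 \<tau>s by (simp add: algebra_simps)
    have a_new: "a i = \<sigma> * \<tau>" if "i \<in> I" "i > k" for i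
    proof -
      have "\<sigma> * a i = \<tau>"
        using \<tau>(1)[of "i - Suc k"] that g_gt_2 by (auto simp: I_def)
      then show ?thesis using \<sigma>(2) by (metis mult.assoc mult_1)
    qed
    \<comment> \<open>The factor \<open>g - 1\<close> allows \<open>gs\<close> to replace
      \<open>\<tau>\<close>. As every \<open>h' j\<close> is positive, one zero coefficient forces
      \<open>t = 0\<close>.\<close>
    have a_h': "a i * (int g - 1) = t * h' i" if "i \<in> I" for i
    proof -
      consider "i = 0" | "i \<in> {1..k}" | "i > k" by force
      then show ?thesis
      proof cases
        case 1
        have "a 0 * (int g - 1) = (t * h 0 - (int g - 2) * \<tau>) * (int g - 1)"
          using t0 by (simp add: eq_diff_eq)
        also have "\<dots> = t * h 0 * (int g - 1) - (int g - 2) * ((int g - 1) * \<tau>)"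
          by (simp only: algebra_simps)
        also have "\<dots> = t * h' 0" unfolding gs by (simp add: h'_def algebra_simps)
        finally show ?thesis using 1 by simp
      next
        case 2
        then show ?thesis using t_pos by (simp add: h'_def)
      next
        case 3
        then have "a i * (int g - 1) = \<sigma> * ((int g - 1) * \<tau>)" using a_new that by simp
        also have "\<dots> = t * \<bar>s\<bar>" unfolding gs by (auto simp: \<sigma>_def)
        finally show ?thesis using 3 by (simp add: h'_def)
      qed
    qed
    then have "t = 0" using a_h'[OF j(1)] j(2) h'_pos[of j] by simp
    then show "a i = 0" using a_h'[OF i] g_gt_2 by simp
  qed

  \<comment> \<open>Sum of the coefficients and the lower bound\<close>
  define q where "q = (if s \<ge> 0 then (int g - 1) * (\<Sum>i = 0..k. h i) + (2 * int g - 3) * s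
    else (int g - 1) * (\<Sum>i = 0..k. h i) - s)"
  have sum_h'_q: "(\<Sum>i\<in>I. h' i) = q"
  proof -
    have "(\<Sum>i = 0..k. h' i) = (\<Sum>i = 0..k. (int g - 1) * h i) + (int g - 2) * s"
    proof -
      have "(\<Sum>i = Suc 0..k. h' i) = (\<Sum>i = Suc 0..k. (int g - 1) * h i)"
        by (rule sum.cong) (auto simp: h'_def)
      then show ?thesis by (simp add: sum.atLeast_Suc_atMost h'_def)
    qed
    moreover have "(\<Sum>m<g - 1. h' (Suc k + m)) = (int g - 1) * \<bar>s\<bar>"
      using g_gt_2 by (simp add: h'_def of_nat_diff)
    ultimately show ?thesis
      \<comment> \<open>The terms \<open>(g - 2) * s\<close> and
        \<open>(g - 1) * \<bar>s\<bar>\<close> add up to \<open>(2 * g - 3) * s\<close> for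
        nonnegative \<open>s\<close> and to \<open>- s\<close> for negative
        \<open>s\<close>.\<close>
      unfolding sum_I sum_distrib_left [symmetric]
      by (cases "s \<ge> 0") (simp_all add: q_def left_diff_distrib right_diff_distrib)
  qed
  have "enat (nat q) \<le> graver_complexity (nfold_mat (Suc M) A)"
    unfolding sum_h'_q[symmetric]
    by (rule primitive_relation_le_graver_complexity[OF C y_graver y_prim h'_pos])
  then show ?thesis
    using y_prim y_graver sum_h'_q unfolding Let_def q_def[symmetric] I_def Suc_eq_plus1[symmetric]
    by blast
qed

end
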